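(* Let $X=\ell^2$ and let $S:\operatorname{dom} S\subseteq X\to X$ be the linear operator with $$\operatorname{dom} S=\Big\{y=(y_n)_{n\ge 1}\in\ell^2 \;\Big|\; \sum_{i\ge 1}y_i=0,\ \Big(\sum_{i\le n}y_i\Big)_{n\ge 1}\in\ell^2\Big\},\qquad Sy=\Big(\sum_{i<n}y_i+\tfrac12 y_n\Big)_{n\ge 1}\quad (y\in\operatorname{dom} S).$$ Then for all $(x,x^* )\in X\times X$, $$F_{S+S^*}(x,x^* )=\iota_{X\times\{0\}}(x,x^* ),$$ $$(F_S\Box_2F_{S^*})(x,x^* )=\begin{cases}\tfrac12 s^2, & \text{if } (x,x^* )\in\operatorname{dom}S^*\times\{0\},\ \text{with } s=\sum_{i\ge 1}x_i;\\ \infty, & \text{otherwise.}\end{cases}$$ Consequently, $F_S\Box_2F_{S^*}\ne F_{S+S^*}$.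
   Context: $\ell^2$ is the real Hilbert space of square-summable real sequences $(x_1,x_2,\dots)$ with inner product $\langle\cdot,\cdot\rangle$. Infinite series are limits of partial sums (the series $\sum_{i\ge1}x_i$ converges for every $x\in\operatorname{dom}S^*$), and $\sum_{i<1}y_i=0$. For a set-valued operator $A:X\rightrightarrows X$, $\operatorname{gra}A=\{(x,x^* )\in X\times X\mid x^*\in Ax\}$ and $\operatorname{dom}A=\{x\mid Ax\neq\varnothing\}$. A linear single-valued operator with domain $\operatorname{dom}S$ is identified with the at most single-valued set-valued operator having the same graph. The adjoint is defined by $\operatorname{gra}A^*=\{(x,x^* )\mid (x^*,-x)\in(\operatorname{gra}A)^\perp\}$. The sum is $(A+B)x=Ax+Bx$ with domain $\operatorname{dom}A\cap\operatorname{dom}B$. The Fitzpatrick function of $A$ is $F_A:X\times X\to\,]-\infty,+\infty]$, $F_A(x,x^* )=\sup_{(a,a^* )\in\operatorname{gra}A}\big(\langle x,a^*\rangle+\langle a,x^*\rangle-\langle a,a^*\rangle\big)$. For $F_1,F_2:X\times X\to\,]-\infty,+\infty]$, the partial inf-convolution is $(F_1\Box_2F_2)(x,x^* )=\inf_{y^*\in X}\big(F_1(x,x^*-y^* )+F_2(x,y^* )\big)$. For a set $C$, $\iota_C$ is its indicator function ($0$ on $C$, $+\infty$ off $C$). *)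

theory Defs
  imports "HOL-Analysis.Analysis"
begin

section \<open>The real Hilbert space of square-summable sequences\<close>

definition square_summable :: "(nat \<Rightarrow> real) set" where
  "square_summable = {x. summable (\<lambda>n. (x n)\<^sup>2)}"

lemma square_summable_zero: "(\<lambda>n. 0) \<in> square_summable"
  by (simp add: square_summable_def)

lemma square_summable_scale:
  assumes "x \<in> square_summable"
  shows "(\<lambda>n. c * x n) \<in> square_summable"
  using assms by (auto simp: square_summable_def power_mult_distrib intro: summable_mult)

lemma square_summable_mult:
  assumes "x \<in> square_summable" "y \<in> square_summable"
  shows "summable (\<lambda>n. x n * y n)"
proof (rule summable_comparison_test')
  show "summable (\<lambda>n. (x n)\<^sup>2 + (y n)\<^sup>2)"
    using assms by (auto simp: square_summable_def intro: summable_add)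
  show "norm (x n * y n) \<le> (x n)\<^sup>2 + (y n)\<^sup>2" for n
  proof -
    have "2 * (\<bar>x n\<bar> * \<bar>y n\<bar>) \<le> (x n)\<^sup>2 + (y n)\<^sup>2"
      using sum_squares_bound[of "\<bar>x n\<bar>" "\<bar>y n\<bar>"] by simp
    moreover have "0 \<le> \<bar>x n\<bar> * \<bar>y n\<bar>" by simp
    ultimately show ?thesis unfolding real_norm_def abs_mult by linarith
  qed
qed

lemma square_summable_add:
  assumes "x \<in> square_summable" "y \<in> square_summable"
  shows "(\<lambda>n. x n + y n) \<in> square_summable"
proof -
  have "summable (\<lambda>n. (x n)\<^sup>2 + (y n)\<^sup>2 + 2 * (x n * y n))"
    using assms square_summable_mult[OF assms]
    by (intro summable_add summable_mult) (auto simp: square_summable_def)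
  then show ?thesis
    by (simp add: square_summable_def power2_sum mult.assoc)
qed

lemma square_summable_diff:
  assumes "x \<in> square_summable" "y \<in> square_summable"
  shows "(\<lambda>n. x n - y n) \<in> square_summable"
  using square_summable_add[OF assms(1) square_summable_scale[OF assms(2), of "-1"]] by simp

text \<open>Sequences are indexed from 0, so that \<open>coord x n\<close> is the entry \<open>x\<^sub>n\<^sub>+\<^sub>1\<close> of the
  1-based sequence.\<close>

typedef ell2 = square_summable
  morphisms coord Abs_ell2
  using square_summable_zero by blast

lemma coord_square_summable [simp]: "coord x \<in> square_summable"
  by (rule coord)

lemma ell2_eqI: "(\<And>n. coord x n = coord y n) \<Longrightarrow> x = y"
  by (metis coord_inject ext)

instantiation ell2 :: real_inner
begin

definition "0 = Abs_ell2 (\<lambda>n. 0)"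
definition "x + y = Abs_ell2 (\<lambda>n. coord x n + coord y n)"
definition "x - y = Abs_ell2 (\<lambda>n. coord x n - coord y n)"
definition "- x = Abs_ell2 (\<lambda>n. - coord x n)"
definition "c *\<^sub>R x = Abs_ell2 (\<lambda>n. c * coord x n)"
definition "x \<bullet> y = (\<Sum>n. coord x n * coord y n)"
definition "norm (x::ell2) = sqrt (x \<bullet> x)"
definition "sgn (x::ell2) = inverse (norm x) *\<^sub>R x"
definition "dist (x::ell2) y = norm (x - y)"
definition "(uniformity :: (ell2 \<times> ell2) filter) = (INF e\<in>{0<..}. principal {(x, y). dist x y < e})"
definition "open (U :: ell2 set) \<longleftrightarrow> (\<forall>x\<in>U. \<forall>\<^sub>F (x', y) in uniformity. x' = x \<longrightarrow> y \<in> U)"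

lemma coord_zero [simp]: "coord 0 n = 0"
  by (simp add: zero_ell2_def Abs_ell2_inverse square_summable_zero)

lemma coord_add [simp]: "coord (x + y) n = coord x n + coord y n"
  by (simp add: plus_ell2_def Abs_ell2_inverse square_summable_add)

lemma coord_diff [simp]: "coord (x - y) n = coord x n - coord y n"
  by (simp add: minus_ell2_def Abs_ell2_inverse square_summable_diff)

lemma coord_uminus [simp]: "coord (- x) n = - coord x n"
  using square_summable_scale[of "coord x" "-1"]
  by (simp add: uminus_ell2_def Abs_ell2_inverse)

lemma coord_scaleR [simp]: "coord (c *\<^sub>R x) n = c * coord x n"
  by (simp add: scaleR_ell2_def Abs_ell2_inverse square_summable_scale)

lemma summable_coord_mult [simp]: "summable (\<lambda>n. coord x n * coord y n)"
  by (simp add: square_summable_mult)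

instance
proof
  fix x y z :: ell2 and a b :: real
  show "x \<bullet> y = y \<bullet> x"
    by (simp add: inner_ell2_def mult.commute)
  show "(x + y) \<bullet> z = x \<bullet> z + y \<bullet> z"
    by (simp add: inner_ell2_def distrib_right suminf_add)
  show "(a *\<^sub>R x) \<bullet> y = a * (x \<bullet> y)"
    by (simp add: inner_ell2_def mult.assoc suminf_mult)
  show "0 \<le> x \<bullet> x"
    by (simp add: inner_ell2_def suminf_nonneg)
  show "x \<bullet> x = 0 \<longleftrightarrow> x = 0"
    using suminf_eq_zero_iff[of "\<lambda>n. coord x n * coord x n"]
    by (auto simp: inner_ell2_def intro: ell2_eqI)
qed (auto simp: norm_ell2_def sgn_ell2_def dist_ell2_def uniformity_ell2_def open_ell2_def
        algebra_simps intro: ell2_eqI)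

end

lemma norm_ell2_power2: "(norm (x::ell2))\<^sup>2 = (\<Sum>n. (coord x n)\<^sup>2)"
  by (simp add: power2_norm_eq_inner) (simp add: inner_ell2_def power2_eq_square)

lemma summable_coord_power2: "summable (\<lambda>n. (coord x n)\<^sup>2)"
  using coord_square_summable[of x] by (simp add: square_summable_def)

lemma abs_coord_le_norm: "\<bar>coord x n\<bar> \<le> norm x"
proof -
  have "(coord x n)\<^sup>2 \<le> (norm x)\<^sup>2"
    unfolding norm_ell2_power2
    using sum_le_suminf[OF summable_coord_power2, of "{n}" x] by simp
  then show ?thesis
    using abs_le_square_iff[of "coord x n" "norm x"] by simp
qed

instance ell2 :: complete_space
proof
  fix X :: "nat \<Rightarrow> ell2"
  assume X: "Cauchy X"
  have "Cauchy (\<lambda>m. coord (X m) n)" for n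
    unfolding Cauchy_def
  proof (intro allI impI)
    fix e :: real assume "e > 0"
    with X obtain M where M: "\<forall>m\<ge>M. \<forall>k\<ge>M. dist (X m) (X k) < e"
      unfolding Cauchy_def by blast
    have "dist (coord (X m) n) (coord (X k) n) \<le> dist (X m) (X k)" for m k
      using abs_coord_le_norm[of "X m - X k" n] by (simp add: dist_norm)
    with M show "\<exists>M. \<forall>m\<ge>M. \<forall>k\<ge>M. dist (coord (X m) n) (coord (X k) n) < e"
      by (meson le_less_trans)
  qed
  then have "\<exists>l. (\<lambda>m. coord (X m) n) \<longlonglongrightarrow> l" for n
    by (simp add: Cauchy_convergent convergent_def[symmetric])
  then obtain l where l: "\<And>n. (\<lambda>m. coord (X m) n) \<longlonglongrightarrow> l n"
    by metis
  have bound: "\<exists>M. \<forall>m\<ge>M. \<forall>N. (\<Sum>n<N. (coord (X m) n - l n)\<^sup>2) \<le> e\<^sup>2" if "e > 0" for e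
  proof -
    from X that obtain M where M: "\<forall>m\<ge>M. \<forall>k\<ge>M. dist (X m) (X k) < e"
      unfolding Cauchy_def by blast
    have "(\<Sum>n<N. (coord (X m) n - l n)\<^sup>2) \<le> e\<^sup>2" if m: "m \<ge> M" for m N
    proof (rule LIMSEQ_le_const2)
      show "(\<lambda>k. \<Sum>n<N. (coord (X m) n - coord (X k) n)\<^sup>2) \<longlonglongrightarrow> (\<Sum>n<N. (coord (X m) n - l n)\<^sup>2)"
        by (intro tendsto_intros l)
      have "(\<Sum>n<N. (coord (X m) n - coord (X k) n)\<^sup>2) \<le> e\<^sup>2" if k: "k \<ge> M" for k
      proof -
        have "(\<Sum>n<N. (coord (X m) n - coord (X k) n)\<^sup>2) \<le> (norm (X m - X k))\<^sup>2"
          unfolding norm_ell2_power2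
          using sum_le_suminf[OF summable_coord_power2, of "{..<N}" "X m - X k"] by simp
        also have "\<dots> \<le> e\<^sup>2"
          using M m k by (intro power_mono) (auto simp: dist_norm less_imp_le)
        finally show ?thesis .
      qed
      then show "\<exists>K. \<forall>k\<ge>K. (\<Sum>n<N. (coord (X m) n - coord (X k) n)\<^sup>2) \<le> e\<^sup>2"
        by blast
    qed
    then show ?thesis by blast
  qed
  have diff: "(\<lambda>n. coord (X m) n - l n) \<in> square_summable"
    if "\<forall>N. (\<Sum>n<N. (coord (X m) n - l n)\<^sup>2) \<le> B" for m B
    unfolding square_summable_def mem_Collect_eq
    using that by (intro summableI_nonneg_bounded) auto
  obtain M where "\<forall>N. (\<Sum>n<N. (coord (X M) n - l n)\<^sup>2) \<le> 1\<^sup>2"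
    using bound[of 1] by auto
  then have l_mem: "l \<in> square_summable"
    using square_summable_diff[OF coord_square_summable[of "X M"] diff[of M "1\<^sup>2"]] by simp
  define L where "L = Abs_ell2 l"
  have L: "coord L = l"
    by (simp add: L_def Abs_ell2_inverse l_mem)
  have "X \<longlonglongrightarrow> L"
  proof (rule LIMSEQ_I)
    fix e :: real assume "e > 0"
    then obtain M where M: "\<forall>m\<ge>M. \<forall>N. (\<Sum>n<N. (coord (X m) n - l n)\<^sup>2) \<le> (e/2)\<^sup>2"
      using bound[of "e/2"] by auto
    have "norm (X m - L) < e" if "m \<ge> M" for m
    proof -
      have "(norm (X m - L))\<^sup>2 \<le> (e/2)\<^sup>2"
        unfolding norm_ell2_power2
        using M that summable_coord_power2[of "X m - L"]
        by (intro suminf_le_const) (auto simp: L)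
      then have "norm (X m - L) \<le> e/2"
        by (rule power2_le_imp_le) (use \<open>e > 0\<close> in simp)
      with \<open>e > 0\<close> show ?thesis by simp
    qed
    then show "\<exists>M. \<forall>m\<ge>M. norm (X m - L) < e" by blast
  qed
  then show "convergent X"
    by (rule convergentI)
qed


section \<open>Set-valued operators\<close>

type_synonym 'a operator = "'a \<Rightarrow> 'a set"

definition gra :: "'a operator \<Rightarrow> ('a \<times> 'a) set" where
  "gra A = {(x, u). u \<in> A x}"

definition op_dom :: "'a operator \<Rightarrow> 'a set" where
  "op_dom A = {x. A x \<noteq> {}}"

definition op_of_map :: "'a set \<Rightarrow> ('a \<Rightarrow> 'a) \<Rightarrow> 'a operator" where
  "op_of_map D T x = (if x \<in> D then {T x} else {})"

definition op_adjoint :: "'a::real_inner operator \<Rightarrow> 'a operator" where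
  "op_adjoint A x = {u. (u, - x) \<in> (gra A)\<^sup>\<bottom>}"

definition op_sum :: "'a::real_inner operator \<Rightarrow> 'a operator \<Rightarrow> 'a operator" where
  "op_sum A B x = {u + v | u v. u \<in> A x \<and> v \<in> B x}"

lemma op_dom_sum: "op_dom (op_sum A B) = op_dom A \<inter> op_dom B"
  by (auto simp: op_dom_def op_sum_def)

definition fitzpatrick :: "'a::real_inner operator \<Rightarrow> 'a \<times> 'a \<Rightarrow> ereal" where
  "fitzpatrick A = (\<lambda>(x, u). SUP (a, b)\<in>gra A. ereal (x \<bullet> b + a \<bullet> u - a \<bullet> b))"

definition partial_inf_conv ::
    "('a::real_inner \<times> 'a \<Rightarrow> ereal) \<Rightarrow> ('a \<times> 'a \<Rightarrow> ereal) \<Rightarrow> 'a \<times> 'a \<Rightarrow> ereal"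
    (infixl \<open>\<box>\<^sub>2\<close> 70) where
  "F \<box>\<^sub>2 G = (\<lambda>(x, u). INF v. F (x, u - v) + G (x, v))"

definition convex_indicator :: "'b set \<Rightarrow> 'b \<Rightarrow> ereal" where
  "convex_indicator C z = (if z \<in> C then 0 else \<infinity>)"


section \<open>The operator S\<close>

definition S_dom :: "ell2 set" where
  "S_dom = {y. coord y sums 0 \<and> (\<lambda>n. \<Sum>i\<le>n. coord y i) \<in> square_summable}"

text \<open>Only meaningful on \<open>S_dom\<close>, where the sequence is square-summable (see \<open>coord_S_map\<close>).\<close>

definition S_map :: "ell2 \<Rightarrow> ell2" where
  "S_map y = Abs_ell2 (\<lambda>n. (\<Sum>i<n. coord y i) + 1/2 * coord y n)"

definition S_op :: "ell2 operator" where
  "S_op = op_of_map S_dom S_map"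

lemma coord_S_map:
  assumes "y \<in> S_dom"
  shows "coord (S_map y) n = (\<Sum>i<n. coord y i) + 1/2 * coord y n"
proof -
  have "(\<lambda>n. (\<Sum>i\<le>n. coord y i) - 1/2 * coord y n) \<in> square_summable"
    using assms
    by (intro square_summable_diff square_summable_scale coord_square_summable)
       (simp add: S_dom_def)
  also have "(\<lambda>n. (\<Sum>i\<le>n. coord y i) - 1/2 * coord y n)
      = (\<lambda>n. (\<Sum>i<n. coord y i) + 1/2 * coord y n)"
    by (simp add: lessThan_Suc_atMost[symmetric] add.commute)
  finally show ?thesis
    by (simp add: S_map_def Abs_ell2_inverse)
qed

lemma op_dom_S: "op_dom S_op = S_dom"
  by (auto simp: op_dom_def S_op_def op_of_map_def)

lemma subspace_S_dom: "subspace S_dom"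
proof (rule subspaceI)
  show "0 \<in> S_dom"
    by (simp add: S_dom_def square_summable_zero sums_def)
  show "x + y \<in> S_dom" if "x \<in> S_dom" "y \<in> S_dom" for x y
    using that sums_add[of "coord x" 0 "coord y" 0]
    by (auto simp: S_dom_def sums_def sum.distrib square_summable_add)
  show "c *\<^sub>R x \<in> S_dom" if "x \<in> S_dom" for c x
    using that sums_mult[of "coord x" 0 c]
    by (auto simp: S_dom_def sums_def sum_distrib_left[symmetric] square_summable_scale)
qed

lemma S_map_linear:
  assumes "x \<in> S_dom" "y \<in> S_dom"
  shows "S_map (a *\<^sub>R x + b *\<^sub>R y) = a *\<^sub>R S_map x + b *\<^sub>R S_map y"
proof (rule ell2_eqI)
  have "a *\<^sub>R x + b *\<^sub>R y \<in> S_dom"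
    by (intro subspace_add subspace_scale subspace_S_dom assms)
  then show "coord (S_map (a *\<^sub>R x + b *\<^sub>R y)) n = coord (a *\<^sub>R S_map x + b *\<^sub>R S_map y) n" for n
    by (simp add: coord_S_map assms sum.distrib sum_distrib_left algebra_simps)
qed

text \<open>The series in the theorem converges: testing the adjoint against \<open>e\<^sub>n - e\<^sub>n\<^sub>+\<^sub>1\<close> makes
  the averages of consecutive entries telescope.\<close>

lemma summable_coord_dom_adjoint:
  assumes "x \<in> op_dom (op_adjoint S_op)"
  shows "summable (coord x)"
proof -
  obtain u where u: "u \<in> op_adjoint S_op x"
    using assms by (auto simp: op_dom_def)
  have adj: "y \<bullet> u = S_map y \<bullet> x" if "y \<in> S_dom" for y
  proof -
    have "(y, S_map y) \<in> gra S_op"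
      using that by (simp add: gra_def S_op_def op_of_map_def)
    then show ?thesis
      using u by (auto simp: op_adjoint_def orthogonal_comp_def orthogonal_def)
  qed
  have avg: "1/2 * coord x n + 1/2 * coord x (Suc n) = coord u n - coord u (Suc n)" for n
  proof -
    define f where "f k = (if k = n then 1 else if k = Suc n then -1 else (0::real))" for k
    have fin: "finite {n, Suc n}" by simp
    have f0: "f k = 0" if "k \<notin> {n, Suc n}" for k
      using that by (auto simp: f_def)
    have "f \<in> square_summable"
      unfolding square_summable_def mem_Collect_eq
      by (rule summable_finite[OF fin]) (simp add: f0)
    then have cf: "coord (Abs_ell2 f) = f"
      by (simp add: Abs_ell2_inverse)
    have ps: "(\<Sum>i\<le>k. f i) = (if k = n then 1 else 0)" for k
      by (induction k) (auto simp: f_def)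
    have ps': "(\<Sum>i<k. f i) = (if k = Suc n then 1 else 0)" for k
      by (cases k) (auto simp: lessThan_Suc_atMost ps)
    have "f sums 0"
      using sums_finite[OF fin, of f] f0 by (simp add: f_def)
    moreover have "(\<lambda>k. \<Sum>i\<le>k. f i) \<in> square_summable"
      unfolding square_summable_def mem_Collect_eq
      by (rule summable_finite[of "{n}"]) (auto simp: ps)
    ultimately have mem: "Abs_ell2 f \<in> S_dom"
      by (simp add: S_dom_def cf)
    have Sf: "coord (S_map (Abs_ell2 f)) k = (if k \<in> {n, Suc n} then 1/2 else 0)" for k
      by (simp add: coord_S_map[OF mem] cf ps') (simp add: f_def)
    have "S_map (Abs_ell2 f) \<bullet> x = (\<Sum>k\<in>{n, Suc n}. coord (S_map (Abs_ell2 f)) k * coord x k)"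
      unfolding inner_ell2_def by (rule suminf_finite[OF fin]) (simp add: Sf)
    moreover have "Abs_ell2 f \<bullet> u = (\<Sum>k\<in>{n, Suc n}. f k * coord u k)"
      unfolding inner_ell2_def cf by (rule suminf_finite[OF fin]) (simp add: f0)
    ultimately show ?thesis
      using adj[OF mem] by (simp add: Sf) (simp add: f_def)
  qed
  have partial: "(\<Sum>i<N. coord x i) = coord u 0 - coord u N + 1/2 * coord x 0 - 1/2 * coord x N" for N
  proof (induction N)
    case (Suc N)
    then show ?case using avg[of N] by simp
  qed simp
  have null: "coord z \<longlonglongrightarrow> 0" for z
    using tendsto_real_sqrt[OF summable_LIMSEQ_zero[OF summable_coord_power2[of z]]]
    by (simp add: tendsto_rabs_zero_iff)
  have "(\<lambda>N. \<Sum>i<N. coord x i) \<longlonglongrightarrow> coord u 0 - 0 + 1/2 * coord x 0 - 1/2 * 0"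
    unfolding partial by (intro tendsto_intros null)
  then show ?thesis
    by (auto simp: summable_def sums_def)
qed

end

theory Submission
  imports Defs
begin

text \<open>
  Both functions are governed by two facts: \<open>S\<close> is skew, that is
  \<open>\<langle>y, Sy\<rangle> = 0\<close> on its domain, and its domain \<open>D\<close> has trivial orthogonal complement.

  Skewness polarizes to \<open>-Sy \<in> S\<^sup>* y\<close>, and the trivial complement makes \<open>S\<^sup>*\<close> single-valued, so
  \<open>S + S\<^sup>*\<close> is the zero operator on \<open>D\<close>. For a skew linear operator \<open>A\<close> the supremum that defines
  \<open>F\<^sub>A(x, u)\<close> is that of the linear functional \<open>a \<mapsto> \<langle>x, Aa\<rangle> + \<langle>a, u\<rangle>\<close> over the domain, hence \<open>0\<close> or
  \<open>\<infinity>\<close>, and it is \<open>0\<close> exactly when \<open>-u \<in> A\<^sup>* x\<close> (\<open>fitzpatrick_skew\<close>). The zero operator on \<open>D\<close>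
  gives the first formula. For \<open>A = S\<close> only one \<open>v\<close> survives in the partial inf-convolution at
  \<open>(x, u)\<close>, namely \<open>v = u + S\<^sup>* x\<close>, so that its value is \<open>F\<^sub>S\<^sub>*(x, u + S\<^sup>* x)\<close>.

  If \<open>u \<noteq> 0\<close>, testing with the elements \<open>(a, -Sa)\<close> of the graph of \<open>S\<^sup>*\<close> leaves \<open>\<langle>a, u\<rangle>\<close>, which
  is unbounded on \<open>D\<close>. If \<open>u = 0\<close>, the point \<open>(x, S\<^sup>* x)\<close> lies on the graph of \<open>S\<^sup>*\<close>, and a
  Fitzpatrick function of a monotone operator equals \<open>\<langle>x, w\<rangle>\<close> at a point \<open>(x, w)\<close> of its graph.

  What remains about sequences is \<open>\<langle>x, S\<^sup>* x\<rangle> = s\<^sup>2 / 2\<close> with \<open>s = \<Sum>\<^sub>i x\<^sub>i\<close> (\<open>inner_adjoint_S\<close>), which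
  also yields the monotonicity of \<open>S\<^sup>*\<close>: with the tails \<open>t\<^sub>n = \<Sum>\<^sub>i\<^sub>\<ge>\<^sub>n x\<^sub>i\<close> the \<open>n\<close>-th product is
  \<open>(t\<^sub>n + t\<^sub>n\<^sub>+\<^sub>1) / 2 * (t\<^sub>n - t\<^sub>n\<^sub>+\<^sub>1)\<close> and the series telescopes. The first unit vector is in the domain of
  \<open>S\<^sup>*\<close> and has \<open>s = 1\<close>, so the two functions differ at its pair with \<open>0\<close>.
\<close>

section \<open>Skew operators and their adjoints\<close>

lemma gra_op_of_map: "gra (op_of_map D T) = (\<lambda>a. (a, T a)) ` D"
  by (auto simp: gra_def op_of_map_def split: if_splits)

lemma mem_op_adjoint_op_of_map:
  "u \<in> op_adjoint (op_of_map D T) x \<longleftrightarrow> (\<forall>a\<in>D. a \<bullet> u = T a \<bullet> x)"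
  by (auto simp: op_adjoint_def orthogonal_comp_def orthogonal_def gra_op_of_map)

lemma op_adjoint_op_of_map_diff:
  assumes "u \<in> op_adjoint (op_of_map D T) x" "v \<in> op_adjoint (op_of_map D T) y"
  shows "u - v \<in> op_adjoint (op_of_map D T) (x - y)"
  using assms by (simp add: mem_op_adjoint_op_of_map inner_diff_right)

text \<open>A functional of degree one takes all real multiples of each of its values, so its supremum
  over a subspace is finite only if it vanishes.\<close>

lemma SUP_homogeneous_subspace:
  fixes f :: "'a::real_vector \<Rightarrow> real"
  assumes V: "subspace V" and f: "\<And>c a. a \<in> V \<Longrightarrow> f (c *\<^sub>R a) = c * f a"
  shows "(SUP a\<in>V. ereal (f a)) = (if \<forall>a\<in>V. f a = 0 then 0 else \<infinity>)"
proof (cases "\<forall>a\<in>V. f a = 0")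
  case True
  then have "(SUP a\<in>V. ereal (f a)) = (SUP a\<in>V. 0)"
    by (intro SUP_cong) auto
  also have "\<dots> = 0"
    using subspace_0[OF V] by (intro SUP_const) blast
  finally show ?thesis using True by simp
next
  case False
  then obtain a where a: "a \<in> V" "f a \<noteq> 0" by blast
  have "(SUP a\<in>V. ereal (f a)) = \<infinity>"
  proof (rule SUP_PInfty)
    fix n :: nat
    have "(real n / f a) *\<^sub>R a \<in> V" using V a by (simp add: subspace_scale)
    moreover have "f ((real n / f a) *\<^sub>R a) = real n" using a by (simp add: f)
    ultimately show "\<exists>i\<in>V. ereal (real n) \<le> ereal (f i)"
      by (metis order_refl)
  qed
  with False show ?thesis by simp
qed

locale skew_operator =
  fixes D :: "'a::real_inner set" and T :: "'a \<Rightarrow> 'a"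
  assumes subspace: "subspace D"
    and linear_on: "a \<in> D \<Longrightarrow> b \<in> D \<Longrightarrow> T (c *\<^sub>R a + d *\<^sub>R b) = c *\<^sub>R T a + d *\<^sub>R T b"
    and skew: "a \<in> D \<Longrightarrow> a \<bullet> T a = 0"
begin

lemma T_scaleR: "a \<in> D \<Longrightarrow> T (c *\<^sub>R a) = c *\<^sub>R T a"
  using linear_on[of a a c 0] by simp

lemma fitzpatrick_skew:
  "fitzpatrick (op_of_map D T) (x, u) = (if - u \<in> op_adjoint (op_of_map D T) x then 0 else \<infinity>)"
proof -
  have "fitzpatrick (op_of_map D T) (x, u) = (SUP a\<in>D. ereal (x \<bullet> T a + a \<bullet> u - a \<bullet> T a))"
    unfolding fitzpatrick_def gra_op_of_map case_prod_conv image_image ..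
  also have "\<dots> = (SUP a\<in>D. ereal (x \<bullet> T a + a \<bullet> u))"
    by (intro SUP_cong refl) (simp add: skew)
  also have "\<dots> = (if \<forall>a\<in>D. x \<bullet> T a + a \<bullet> u = 0 then 0 else \<infinity>)"
    by (rule SUP_homogeneous_subspace[OF subspace]) (simp add: T_scaleR algebra_simps)
  also have "(\<forall>a\<in>D. x \<bullet> T a + a \<bullet> u = 0) \<longleftrightarrow> - u \<in> op_adjoint (op_of_map D T) x"
  proof -
    have "x \<bullet> T a + a \<bullet> u = 0 \<longleftrightarrow> a \<bullet> - u = T a \<bullet> x" for a
      unfolding inner_minus_right inner_commute[of x] by linarith
    then show ?thesis by (simp add: mem_op_adjoint_op_of_map)
  qed
  finally show ?thesis .
qed

text \<open>Polarization of \<open>\<langle>a, Ta\<rangle> = 0\<close>.\<close>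

lemma uminus_mem_op_adjoint:
  assumes "a \<in> D"
  shows "- T a \<in> op_adjoint (op_of_map D T) a"
  unfolding mem_op_adjoint_op_of_map
proof
  fix b assume b: "b \<in> D"
  have "a + b \<in> D" using assms b by (simp add: subspace subspace_add)
  then have "(a + b) \<bullet> (T a + T b) = 0"
    using skew[of "a + b"] linear_on[OF assms b, of 1 1] by simp
  then show "b \<bullet> - T a = T b \<bullet> a"
    using skew[OF assms] skew[OF b] by (simp add: inner_add inner_commute)
qed

end

text \<open>In a Hilbert space the extra condition says that \<open>D\<close> is dense.\<close>

locale total_skew_operator = skew_operator +
  assumes total: "(\<And>a. a \<in> D \<Longrightarrow> a \<bullet> z = 0) \<Longrightarrow> z = 0"
begin

lemma op_adjoint_unique:
  assumes "u \<in> op_adjoint (op_of_map D T) x" "v \<in> op_adjoint (op_of_map D T) x"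
  shows "u = v"
  using total[of "u - v"] assms by (simp add: mem_op_adjoint_op_of_map inner_diff_right)

lemma op_sum_adjoint:
  "op_sum (op_of_map D T) (op_adjoint (op_of_map D T)) = op_of_map D (\<lambda>_. 0)"
proof
  fix a
  have "op_adjoint (op_of_map D T) a = {- T a}" if "a \<in> D"
    using uminus_mem_op_adjoint[OF that] op_adjoint_unique by blast
  then show "op_sum (op_of_map D T) (op_adjoint (op_of_map D T)) a = op_of_map D (\<lambda>_. 0) a"
    by (auto simp: op_sum_def op_of_map_def)
qed

lemma fitzpatrick_sum_adjoint:
  "fitzpatrick (op_sum (op_of_map D T) (op_adjoint (op_of_map D T))) (x, u)
     = (if u = 0 then 0 else \<infinity>)"
proof -
  interpret zero: skew_operator D "\<lambda>_. 0"
    by unfold_locales (simp_all add: subspace)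
  have "- u \<in> op_adjoint (op_of_map D (\<lambda>_. 0)) x \<longleftrightarrow> u = 0"
    using total[of u] by (auto simp: mem_op_adjoint_op_of_map)
  then show ?thesis
    by (simp add: op_sum_adjoint zero.fitzpatrick_skew)
qed

lemma partial_inf_conv_eq_infinity:
  assumes "x \<notin> op_dom (op_adjoint (op_of_map D T))"
  shows "(fitzpatrick (op_of_map D T) \<box>\<^sub>2 G) (x, u) = \<infinity>"
  using assms by (simp add: partial_inf_conv_def fitzpatrick_skew op_dom_def)

text \<open>By \<open>fitzpatrick_skew\<close> the first summand at \<open>v\<close> is finite only if \<open>v - u\<close> lies in the
  adjoint at \<open>x\<close>, which is a singleton.\<close>

lemma partial_inf_conv_eq:
  assumes w: "w \<in> op_adjoint (op_of_map D T) x"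
  shows "(fitzpatrick (op_of_map D T) \<box>\<^sub>2 G) (x, u) = G (x, u + w)"
proof -
  have F: "fitzpatrick (op_of_map D T) (x, u - v) = (if v = u + w then 0 else \<infinity>)" for v
  proof -
    have "v - u \<in> op_adjoint (op_of_map D T) x \<longleftrightarrow> v - u = w"
      using w op_adjoint_unique by blast
    also have "\<dots> \<longleftrightarrow> v = u + w"
      by (auto simp: algebra_simps)
    finally show ?thesis by (simp add: fitzpatrick_skew)
  qed
  show ?thesis
    unfolding partial_inf_conv_def case_prod_conv F
    by (rule antisym) (auto intro!: INF_greatest intro: INF_lower2[of "u + w"])
qed

text \<open>The bound used here is monotonicity of the adjoint in the form
  \<open>\<langle>x - a, w - b\<rangle> \<ge> 0\<close>, rearranged; it is an equality for \<open>(a, b) = (x, w)\<close>.\<close>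

lemma fitzpatrick_adjoint_graph:
  assumes mono: "\<And>x w. w \<in> op_adjoint (op_of_map D T) x \<Longrightarrow> 0 \<le> x \<bullet> w"
    and w: "w \<in> op_adjoint (op_of_map D T) x"
  shows "fitzpatrick (op_adjoint (op_of_map D T)) (x, w) = ereal (x \<bullet> w)"
proof -
  have "x \<bullet> b + a \<bullet> w - a \<bullet> b \<le> x \<bullet> w" if "b \<in> op_adjoint (op_of_map D T) a" for a b
    using mono[OF op_adjoint_op_of_map_diff[OF w that]] by (simp add: inner_diff)
  then show ?thesis
    unfolding fitzpatrick_def case_prod_conv
    using w
    by (intro antisym) (auto simp: gra_def intro!: SUP_least intro: SUP_upper2[of "(x, w)"])
qed

text \<open>Restricting the supremum to the points \<open>(a, -Ta)\<close> of the graph of the adjoint leaves only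
  \<open>\<langle>a, u\<rangle>\<close>.\<close>

lemma fitzpatrick_adjoint_off_graph:
  assumes w: "w \<in> op_adjoint (op_of_map D T) x" and u: "u \<noteq> 0"
  shows "fitzpatrick (op_adjoint (op_of_map D T)) (x, u + w) = \<infinity>"
proof -
  have eq: "x \<bullet> - T a + a \<bullet> (u + w) - a \<bullet> - T a = a \<bullet> u" if "a \<in> D" for a
    using w that by (simp add: mem_op_adjoint_op_of_map inner_add_right skew inner_commute[of x])
  have "\<not> (\<forall>a\<in>D. a \<bullet> u = 0)" using total[of u] u by blast
  then have "\<infinity> = (SUP a\<in>D. ereal (a \<bullet> u))"
    using SUP_homogeneous_subspace[OF subspace, of "\<lambda>a. a \<bullet> u"] by simp
  also have "\<dots> \<le> fitzpatrick (op_adjoint (op_of_map D T)) (x, u + w)"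
    unfolding fitzpatrick_def case_prod_conv
  proof (rule SUP_mono)
    fix a assume "a \<in> D"
    then show "\<exists>p\<in>gra (op_adjoint (op_of_map D T)). ereal (a \<bullet> u) \<le>
        (case p of (a, b) \<Rightarrow> ereal (x \<bullet> b + a \<bullet> (u + w) - a \<bullet> b))"
      using uminus_mem_op_adjoint eq
      by (intro bexI[of _ "(a, - T a)"]) (auto simp: gra_def)
  qed
  finally show ?thesis by simp
qed

lemma partial_inf_conv_adjoint:
  assumes mono: "\<And>x w. w \<in> op_adjoint (op_of_map D T) x \<Longrightarrow> 0 \<le> x \<bullet> w"
    and w: "w \<in> op_adjoint (op_of_map D T) x"
  shows "(fitzpatrick (op_of_map D T) \<box>\<^sub>2 fitzpatrick (op_adjoint (op_of_map D T))) (x, u)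
     = (if u = 0 then ereal (x \<bullet> w) else \<infinity>)"
  using fitzpatrick_adjoint_graph[OF mono w] fitzpatrick_adjoint_off_graph[OF w]
  by (cases "u = 0") (simp_all add: partial_inf_conv_eq[OF w])

end


section \<open>The partial-sum operator and its adjoint\<close>

definition unit_seq :: "nat \<Rightarrow> ell2" where
  "unit_seq n = Abs_ell2 (\<lambda>k. of_bool (k = n))"

lemma coord_unit_seq [simp]: "coord (unit_seq n) k = of_bool (k = n)"
proof -
  have "(\<lambda>k. of_bool (k = n)) \<in> square_summable"
    unfolding square_summable_def mem_Collect_eq
    by (rule summable_finite[of "{n}"]) auto
  then show ?thesis by (simp add: unit_seq_def Abs_ell2_inverse)
qed

lemma inner_unit_seq [simp]: "x \<bullet> unit_seq n = coord x n"
  unfolding inner_ell2_def by (subst suminf_finite[of "{n}"]) auto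

lemma coord_tendsto_zero: "coord x \<longlonglongrightarrow> 0"
  using tendsto_real_sqrt[OF summable_LIMSEQ_zero[OF summable_coord_power2[of x]]]
  by (simp add: tendsto_rabs_zero_iff)

text \<open>With the partial sums \<open>\<sigma>\<^sub>n = \<Sum>\<^sub>i\<^sub><\<^sub>n y\<^sub>i\<close>, the \<open>n\<close>-th product is
  \<open>(\<sigma>\<^sub>n + \<sigma>\<^sub>n\<^sub>+\<^sub>1) / 2 * (\<sigma>\<^sub>n\<^sub>+\<^sub>1 - \<sigma>\<^sub>n)\<close>; the series telescopes and \<open>\<sigma>\<^sub>n\<close> tends to \<open>0\<close>.\<close>

lemma inner_S_map:
  assumes "y \<in> S_dom"
  shows "y \<bullet> S_map y = 0"
proof -
  have "(\<lambda>n. (\<Sum>i<n. coord y i)\<^sup>2 / 2) \<longlonglongrightarrow> 0\<^sup>2 / 2"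
    using assms unfolding S_dom_def sums_def by (intro tendsto_intros) auto
  from telescope_sums[OF this]
  have "(\<lambda>n. (\<Sum>i<Suc n. coord y i)\<^sup>2 / 2 - (\<Sum>i<n. coord y i)\<^sup>2 / 2) sums 0" by simp
  also have "(\<lambda>n. (\<Sum>i<Suc n. coord y i)\<^sup>2 / 2 - (\<Sum>i<n. coord y i)\<^sup>2 / 2)
      = (\<lambda>n. coord y n * coord (S_map y) n)"
    by (simp add: fun_eq_iff coord_S_map[OF assms] power2_eq_square field_simps)
  finally show ?thesis by (simp add: inner_ell2_def sums_iff)
qed

lemma unit_seq_diff_mem_S_dom: "unit_seq n - unit_seq (Suc n) \<in> S_dom"
proof -
  have partial: "(\<Sum>i\<le>k. coord (unit_seq n - unit_seq (Suc n)) i) = coord (unit_seq n) k" for k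
    by (induction k) auto
  show ?thesis
    unfolding S_dom_def sums_def_le mem_Collect_eq partial
    using coord_tendsto_zero[of "unit_seq n"] coord_square_summable[of "unit_seq n"] by blast
qed

lemma S_map_unit_seq_diff:
  "S_map (unit_seq n - unit_seq (Suc n)) = (1/2) *\<^sub>R (unit_seq n + unit_seq (Suc n))"
proof (rule ell2_eqI)
  fix k
  have "(\<Sum>i<k. coord (unit_seq n - unit_seq (Suc n)) i) = of_bool (k = Suc n)"
    by (induction k) auto
  then show "coord (S_map (unit_seq n - unit_seq (Suc n))) k
      = coord ((1/2) *\<^sub>R (unit_seq n + unit_seq (Suc n))) k"
    by (simp add: coord_S_map[OF unit_seq_diff_mem_S_dom])
qed

text \<open>A sequence orthogonal to all differences of consecutive unit vectors is constant, and the
  only constant in \<open>\<ell>\<^sup>2\<close> is \<open>0\<close>.\<close>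

lemma S_dom_total:
  assumes "\<And>y. y \<in> S_dom \<Longrightarrow> y \<bullet> z = 0"
  shows "z = 0"
proof -
  have "coord z (Suc n) = coord z n" for n
    using assms[OF unit_seq_diff_mem_S_dom, of n] by (simp add: inner_commute[of _ z] inner_diff)
  then have const: "coord z n = coord z 0" for n
    by (induction n) simp_all
  then have "coord z = (\<lambda>_. coord z 0)" by blast
  then have "coord z \<longlonglongrightarrow> coord z 0"
    by (metis tendsto_const)
  then have "coord z 0 = 0"
    using coord_tendsto_zero LIMSEQ_unique by blast
  with const show ?thesis by (metis coord_zero ell2_eqI)
qed

interpretation S: total_skew_operator S_dom S_map
  by unfold_locales (fact subspace_S_dom S_map_linear inner_S_map S_dom_total)+

text \<open>Testing with \<open>e\<^sub>n - e\<^sub>n\<^sub>+\<^sub>1\<close> shows that \<open>t\<^sub>n = u\<^sub>n + x\<^sub>n / 2\<close> satisfies \<open>t\<^sub>n - t\<^sub>n\<^sub>+\<^sub>1 = x\<^sub>n\<close>; as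
  \<open>t\<^sub>n\<close> tends to \<open>0\<close>, these are the tails of the series of \<open>x\<close>, and \<open>u\<^sub>n = (t\<^sub>n + t\<^sub>n\<^sub>+\<^sub>1) / 2\<close>.\<close>

lemma inner_adjoint_S:
  assumes "u \<in> op_adjoint S_op x"
  shows "x \<bullet> u = 1/2 * (\<Sum>i. coord x i)\<^sup>2"
proof -
  define t where "t n = coord u n + 1/2 * coord x n" for n
  have avg: "coord u n - coord u (Suc n) = 1/2 * (coord x n + coord x (Suc n))" for n
  proof -
    have "(unit_seq n - unit_seq (Suc n)) \<bullet> u = S_map (unit_seq n - unit_seq (Suc n)) \<bullet> x"
      using assms unit_seq_diff_mem_S_dom unfolding S_op_def mem_op_adjoint_op_of_map by blast
    then show ?thesis
      unfolding S_map_unit_seq_diff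
      by (simp add: inner_commute[of _ u] inner_commute[of _ x] inner_diff inner_add)
  qed
  have x: "coord x n = t n - t (Suc n)" and u: "coord u n = 1/2 * (t n + t (Suc n))" for n
    using avg[of n] by (simp_all add: t_def field_simps)
  have t0: "t \<longlonglongrightarrow> 0"
    unfolding t_def
    by (intro tendsto_add_zero tendsto_mult_right_zero coord_tendsto_zero)
  have "coord x sums t 0"
    using telescope_sums'[OF t0] unfolding x[symmetric] by simp
  moreover have "(\<lambda>n. coord x n * coord u n) sums (1/2 * (t 0)\<^sup>2)"
  proof -
    have "(\<lambda>n. 1/2 * (t n)\<^sup>2) \<longlonglongrightarrow> 1/2 * 0\<^sup>2"
      by (intro tendsto_intros t0)
    from telescope_sums'[OF this]
    have "(\<lambda>n. 1/2 * (t n)\<^sup>2 - 1/2 * (t (Suc n))\<^sup>2) sums (1/2 * (t 0)\<^sup>2)" by simp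
    moreover have "1/2 * (t n)\<^sup>2 - 1/2 * (t (Suc n))\<^sup>2 = coord x n * coord u n" for n
      unfolding x u by (simp add: power2_eq_square field_simps)
    ultimately show ?thesis by simp
  qed
  ultimately show ?thesis by (simp add: inner_ell2_def sums_iff)
qed

lemma half_unit_seq_mem_adjoint_S: "(1/2) *\<^sub>R unit_seq 0 \<in> op_adjoint S_op (unit_seq 0)"
  by (simp add: S_op_def mem_op_adjoint_op_of_map coord_S_map)


section \<open>The two Fitzpatrick functions\<close>

lemma fitzpatrick_S_sum:
  "fitzpatrick (op_sum S_op (op_adjoint S_op)) (x, u) = convex_indicator (UNIV \<times> {0}) (x, u)"
  by (simp add: S_op_def S.fitzpatrick_sum_adjoint convex_indicator_def)

lemma partial_inf_conv_S:
  "(fitzpatrick S_op \<box>\<^sub>2 fitzpatrick (op_adjoint S_op)) (x, u)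
     = (if (x, u) \<in> op_dom (op_adjoint S_op) \<times> {0}
        then ereal (1/2 * (\<Sum>i. coord x i)\<^sup>2) else \<infinity>)"
proof (cases "x \<in> op_dom (op_adjoint S_op)")
  case True
  then obtain w where w: "w \<in> op_adjoint S_op x" by (auto simp: op_dom_def)
  have "0 \<le> y \<bullet> v" if "v \<in> op_adjoint S_op y" for y v
    unfolding inner_adjoint_S[OF that] by simp
  then have "(fitzpatrick S_op \<box>\<^sub>2 fitzpatrick (op_adjoint S_op)) (x, u)
      = (if u = 0 then ereal (x \<bullet> w) else \<infinity>)"
    using S.partial_inf_conv_adjoint w unfolding S_op_def by blast
  with True inner_adjoint_S[OF w] show ?thesis by simp
next
  case False
  then show ?thesis
    using S.partial_inf_conv_eq_infinity unfolding S_op_def by simp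
qed

theorem theorem3p19:
  shows "(\<forall>x u. fitzpatrick (op_sum S_op (op_adjoint S_op)) (x, u)
              = convex_indicator (UNIV \<times> {0}) (x, u))
       \<and> (\<forall>x u. (fitzpatrick S_op \<box>\<^sub>2 fitzpatrick (op_adjoint S_op)) (x, u)
              = (if (x, u) \<in> op_dom (op_adjoint S_op) \<times> {0}
                 then ereal (1/2 * (\<Sum>i. coord x i)\<^sup>2) else \<infinity>))
       \<and> fitzpatrick S_op \<box>\<^sub>2 fitzpatrick (op_adjoint S_op)
           \<noteq> fitzpatrick (op_sum S_op (op_adjoint S_op))"
proof (intro conjI allI)
  show "fitzpatrick S_op \<box>\<^sub>2 fitzpatrick (op_adjoint S_op)
      \<noteq> fitzpatrick (op_sum S_op (op_adjoint S_op))"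
  proof
    assume "fitzpatrick S_op \<box>\<^sub>2 fitzpatrick (op_adjoint S_op)
      = fitzpatrick (op_sum S_op (op_adjoint S_op))"
    from fun_cong[OF this, of "(unit_seq 0, 0)"]
    have "(fitzpatrick S_op \<box>\<^sub>2 fitzpatrick (op_adjoint S_op)) (unit_seq 0, 0) = 0"
      by (simp add: fitzpatrick_S_sum convex_indicator_def)
    moreover have "unit_seq 0 \<in> op_dom (op_adjoint S_op)"
      using half_unit_seq_mem_adjoint_S by (auto simp: op_dom_def)
    moreover have "(\<Sum>i. coord (unit_seq 0) i) = 1"
      by (subst suminf_finite[of "{0}"]) auto
    ultimately show False
      by (simp add: partial_inf_conv_S)
  qed
qed (rule fitzpatrick_S_sum, rule partial_inf_conv_S)

end
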